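(* Let $2\le n<m$ be integers, let $I\subseteq\mathbb{R}$ be an interval, let $K_1,\dots,K_m$ be $n$-variable means on $I$ with $K_1\le\dots\le K_m$ pointwise on $I^n$, and let $T=\{t_1,\dots,t_m\}$, $t_i=(j_{i,1},\dots,j_{i,n})$, be an admissible system for $(n,m)$. For $a^{(1)}\le\dots\le a^{(m)}$ in $I$ define $a^{(i)}_0=a^{(i)}$ and $a^{(i)}_{k+1}=K_i(a^{(j_{i,1})}_k,\dots,a^{(j_{i,n})}_k)$ for $1\le i\le m$, $k\ge 0$. Then all $m$ sequences $(a^{(i)}_k)_k$ converge to the same limit, and this limit lies between $a^{(1)}$ and $a^{(m)}$. Moreover, the $m$-variable mean that assigns this limit to $a^{(1)},\dots,a^{(m)}$ is strictly internal, monotone and continuous.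
   Context: An $n$-variable mean on an interval $I$ is a function $K:I^n\to I$ with $\min\{x_1,\dots,x_n\}\le K(x_1,\dots,x_n)\le\max\{x_1,\dots,x_n\}$. It is symmetric if invariant under permutations of its arguments; strictly internal if $\min<K(x_1,\dots,x_n)<\max$ whenever the $x_i$ are not all equal; monotone if $x_i\le y_i$ for all $i$ implies $K(x_1,\dots,x_n)\le K(y_1,\dots,y_n)$; continuous if it is continuous as a function of $n$ variables. Standing assumption: each of the given means $K_1,\dots,K_m$ is symmetric, strictly internal, monotone and continuous. Let $I_m=\{1,\dots,m\}$ and $I_m^n=\{(j_1,\dots,j_n): j_1,\dots,j_n\in I_m\}$. For $t=(j_1,\dots,j_n)\in I_m^n$, "$j\in t$", $\min t$, $\max t$ refer to the set of coordinates. The partial order on $I_m^n$ is coordinatewise. A system $T=\{t_1,\dots,t_m\}$ with $t_i\in I_m^n$ is admissible for $(n,m)$ if: (1) $t_1\le t_2\le\dots\le t_m$; (2) for every $k\in I_m$, $|\{i: k\in t_i\}|=n$; (3) $\min t_i\le i\le\max t_i$ for every $i$, and $\min t_i<i<\max t_i$ if $2\le i\le m-1$; (4) for every $i\ge 2$ there is $j<i$ with $i\in t_j$. The limit is defined for nondecreasing tuples and is extended to arbitrary tuples in $I^m$ by first sorting them in nondecreasing order. *)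

theory Defs
  imports "HOL-Analysis.Analysis"
begin

text \<open>
  An n-tuple over A is a function on the index set 1, ..., n with values in A which is
  \<^const>\<open>undefined\<close> elsewhere. For real tuples the subspace topology inherited from
  \<^typ>\<open>nat \<Rightarrow> real\<close> (the product topology) is therefore the usual topology of the n-fold power.
\<close>

abbreviation tuples :: "nat \<Rightarrow> 'a set \<Rightarrow> (nat \<Rightarrow> 'a) set" where
  "tuples n A \<equiv> {1..n} \<rightarrow>\<^sub>E A"

definition is_mean :: "nat \<Rightarrow> real set \<Rightarrow> ((nat \<Rightarrow> real) \<Rightarrow> real) \<Rightarrow> bool" where
  "is_mean n I K \<longleftrightarrow> (\<forall>x\<in>tuples n I. K x \<in> I \<and>
     Min (x ` {1..n}) \<le> K x \<and> K x \<le> Max (x ` {1..n}))"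

definition symmetric_mean :: "nat \<Rightarrow> real set \<Rightarrow> ((nat \<Rightarrow> real) \<Rightarrow> real) \<Rightarrow> bool" where
  "symmetric_mean n I K \<longleftrightarrow> (\<forall>x\<in>tuples n I. \<forall>\<sigma>. \<sigma> permutes {1..n} \<longrightarrow> K (x \<circ> \<sigma>) = K x)"

definition strictly_internal :: "nat \<Rightarrow> real set \<Rightarrow> ((nat \<Rightarrow> real) \<Rightarrow> real) \<Rightarrow> bool" where
  "strictly_internal n I K \<longleftrightarrow> (\<forall>x\<in>tuples n I. (\<exists>i\<in>{1..n}. \<exists>j\<in>{1..n}. x i \<noteq> x j) \<longrightarrow>
     Min (x ` {1..n}) < K x \<and> K x < Max (x ` {1..n}))"

definition monotone_mean :: "nat \<Rightarrow> real set \<Rightarrow> ((nat \<Rightarrow> real) \<Rightarrow> real) \<Rightarrow> bool" where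
  "monotone_mean n I K \<longleftrightarrow> (\<forall>x\<in>tuples n I. \<forall>y\<in>tuples n I.
     (\<forall>i\<in>{1..n}. x i \<le> y i) \<longrightarrow> K x \<le> K y)"

definition continuous_mean :: "nat \<Rightarrow> real set \<Rightarrow> ((nat \<Rightarrow> real) \<Rightarrow> real) \<Rightarrow> bool" where
  "continuous_mean n I K \<longleftrightarrow> continuous_on (tuples n I) K"

text \<open>
  In a system \<open>t\<close>, the value \<open>t i l\<close> is the l-th coordinate of the i-th tuple.
\<close>

definition admissible :: "nat \<Rightarrow> nat \<Rightarrow> (nat \<Rightarrow> nat \<Rightarrow> nat) \<Rightarrow> bool" where
  "admissible n m t \<longleftrightarrow>
     (\<forall>i\<in>{1..m}. t i \<in> tuples n {1..m}) \<and>
     (\<forall>i\<in>{1..<m}. \<forall>l\<in>{1..n}. t i l \<le> t (Suc i) l) \<and>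
     (\<forall>k\<in>{1..m}. card {i\<in>{1..m}. k \<in> t i ` {1..n}} = n) \<and>
     (\<forall>i\<in>{1..m}. Min (t i ` {1..n}) \<le> i \<and> i \<le> Max (t i ` {1..n})) \<and>
     (\<forall>i\<in>{2..m-1}. Min (t i ` {1..n}) < i \<and> i < Max (t i ` {1..n})) \<and>
     (\<forall>i\<in>{2..m}. \<exists>j\<in>{1..<i}. i \<in> t j ` {1..n})"

primrec mean_iter ::
  "nat \<Rightarrow> nat \<Rightarrow> (nat \<Rightarrow> (nat \<Rightarrow> real) \<Rightarrow> real) \<Rightarrow> (nat \<Rightarrow> nat \<Rightarrow> nat) \<Rightarrow> (nat \<Rightarrow> real) \<Rightarrow>
    nat \<Rightarrow> (nat \<Rightarrow> real)" where
  "mean_iter n m K t a 0 = a"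
| "mean_iter n m K t a (Suc k) =
     (\<lambda>i\<in>{1..m}. K i (\<lambda>l\<in>{1..n}. mean_iter n m K t a k (t i l)))"

definition sort_tuple :: "nat \<Rightarrow> (nat \<Rightarrow> real) \<Rightarrow> (nat \<Rightarrow> real)" where
  "sort_tuple m x = (\<lambda>i\<in>{1..m}. sort (map x [1..<Suc m]) ! (i - 1))"

definition limit_mean ::
  "nat \<Rightarrow> nat \<Rightarrow> (nat \<Rightarrow> (nat \<Rightarrow> real) \<Rightarrow> real) \<Rightarrow> (nat \<Rightarrow> nat \<Rightarrow> nat) \<Rightarrow> (nat \<Rightarrow> real) \<Rightarrow> real" where
  "limit_mean n m K t x =
     (THE L. \<forall>i\<in>{1..m}. (\<lambda>k. mean_iter n m K t (sort_tuple m x) k i) \<longlonglongrightarrow> L)"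

end

theory Submission
  imports Defs
begin

text \<open>
  The iteration preserves nondecreasing tuples, because the tuples \<open>t i\<close>, the means \<open>K i\<close> and
  the entries all increase together. Its least entry, the first one, can therefore only grow, and
  its greatest entry, the last one, can only shrink; let \<open>\<alpha>\<close> be the limit of the first entry.

  Everything else rests on one rigidity: a strictly internal mean attains a lower or upper bound
  of its arguments only if all of them equal that bound (\<open>mean_extremal_imp_constant\<close>), and by
  monotonicity and continuity this persists in the limit
  (\<open>coordinates_tendsto_lower_bound\<close>): if the arguments lie above a sequence tending to \<open>\<alpha>\<close> and the
  mean value tends to \<open>\<alpha>\<close>, then so does every argument. Hence once entry \<open>j\<close> is known to tend to
  \<open>\<alpha>\<close>, all entries read by \<open>t j\<close> tend to \<open>\<alpha>\<close>, and by monotonicity all entries in between.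
  Since for each \<open>i < m\<close> some \<open>t j\<close> with \<open>j \<le> i\<close> reads an entry beyond \<open>i\<close>, convergence to \<open>\<alpha>\<close>
  spreads from entry 1 to entry \<open>m\<close> (\<open>iter_tendsto_common\<close>).

  If the limit were equal to the first entry of the initial tuple, the first entry would never
  move, and the same induction with equalities in place of limits makes all entries equal. For the
  last entry the induction runs downwards, so some \<open>t j\<close> with \<open>j > i\<close> must read an entry at most
  \<open>i\<close>. For \<open>j < m\<close> this is the strict lower inequality in admissibility; for \<open>j = m\<close> it comes from double
  counting: every index occurs in exactly \<open>n\<close> tuples, so every tuple has \<open>n\<close> distinct coordinates
  (\<open>admissible_inj_on\<close>).

  Monotonicity of the limit passes through the iteration. For continuity, the first and the last
  entry after \<open>k\<close> steps are continuous functions of the initial tuple that enclose the limit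
  and come arbitrarily close to it. Sorting is monotone and continuous, so these
  properties carry over from nondecreasing to arbitrary tuples.
\<close>

section \<open>Order statistics\<close>

lemma sorted_nth_le_iff:
  fixes c :: "'a::linorder"
  assumes "sorted xs" "i < length xs"
  shows "xs ! i \<le> c \<longleftrightarrow> i < length (filter (\<lambda>x. x \<le> c) xs)"
  using assms
proof (induction xs arbitrary: i)
  case Nil
  then show ?case by simp
next
  case (Cons y ys)
  show ?case
  proof (cases "y \<le> c")
    case True
    then show ?thesis using Cons by (cases i) auto
  next
    case False
    then have "filter (\<lambda>x. x \<le> c) (y # ys) = []"
      using Cons.prems(1) by (auto simp: filter_empty_conv)
    moreover have "y \<le> (y # ys) ! i"
      using Cons.prems by (cases i) auto
    ultimately show ?thesis using False by (auto simp del: filter.simps)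
  qed
qed

text \<open>
  Describing an order statistic by counting removes the sorting permutation, so that two tuples
  can be compared although they are sorted by different permutations.
\<close>

lemma sort_tuple_le_iff:
  assumes "i \<in> {1..m}"
  shows "sort_tuple m x i \<le> c \<longleftrightarrow> i \<le> card {j \<in> {1..m}. x j \<le> c}"
proof -
  have "length (filter (\<lambda>v. v \<le> c) (sort (map x [1..<Suc m])))
      = length (filter (\<lambda>j. x j \<le> c) [1..<Suc m])"
    by (simp add: filter_sort filter_map o_def del: upt_Suc)
  also have "\<dots> = card {j \<in> {1..m}. x j \<le> c}"
    by (simp add: distinct_card[symmetric] atLeastLessThanSuc_atLeastAtMost del: upt_Suc)
  finally show ?thesis
    using assms by (auto simp: sort_tuple_def sorted_nth_le_iff simp del: upt_Suc)
qed

text \<open>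
  For \<open>e = 0\<close> this is monotonicity of sorting; applied in both directions with \<open>e > 0\<close> it says that
  sorting is 1-Lipschitz for the maximum norm.
\<close>

lemma sort_tuple_le_add:
  assumes "\<And>j. j \<in> {1..m} \<Longrightarrow> x j \<le> y j + e" and "i \<in> {1..m}"
  shows "sort_tuple m x i \<le> sort_tuple m y i + e"
proof -
  let ?c = "sort_tuple m y i"
  have "i \<le> card {j \<in> {1..m}. y j \<le> ?c}"
    using sort_tuple_le_iff[OF assms(2)] by blast
  also have "\<dots> \<le> card {j \<in> {1..m}. x j \<le> ?c + e}"
    using assms(1) by (intro card_mono) force+
  finally show ?thesis
    using sort_tuple_le_iff[OF assms(2)] by blast
qed

lemma sort_tuple_image: "sort_tuple m x ` {1..m} = x ` {1..m}"
proof -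
  let ?xs = "sort (map x [1..<Suc m])"
  have "sort_tuple m x ` {1..m} = sort_tuple m x ` Suc ` {0..<m}"
    by (simp only: image_Suc_atLeastLessThan atLeastLessThanSuc_atLeastAtMost One_nat_def)
  also have "\<dots> = (!) ?xs ` {0..<length ?xs}"
    unfolding image_image by (intro image_cong) (auto simp: sort_tuple_def simp del: upt_Suc)
  also have "\<dots> = x ` {1..m}"
    by (simp only: nth_image[OF order_refl] take_all set_sort set_map set_upt
        atLeastLessThanSuc_atLeastAtMost order_refl)
  finally show ?thesis .
qed

lemma mono_on_sort_tuple: "mono_on {1..m} (sort_tuple m x)"
  by (auto simp: mono_on_def sort_tuple_def intro!: sorted_nth_mono simp del: upt_Suc)

lemma sort_tuple_tuples: "x \<in> tuples m A \<Longrightarrow> sort_tuple m x \<in> tuples m A"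
proof (rule PiE_I)
  fix i assume x: "x \<in> tuples m A" and "i \<in> {1..m}"
  then have "sort_tuple m x i \<in> x ` {1..m}" using sort_tuple_image[of m x] by blast
  also have "\<dots> \<subseteq> A" using x by auto
  finally show "sort_tuple m x i \<in> A" .
qed (auto simp: sort_tuple_def simp del: upt_Suc)

lemma sort_tuple_first: "1 \<le> m \<Longrightarrow> sort_tuple m x 1 = Min (x ` {1..m})"
proof -
  assume "1 \<le> m"
  then have "Min (sort_tuple m x ` {1..m}) = sort_tuple m x 1"
    by (intro Min_eqI) (auto intro!: mono_onD[OF mono_on_sort_tuple])
  then show ?thesis by (simp only: sort_tuple_image)
qed

lemma sort_tuple_last: "1 \<le> m \<Longrightarrow> sort_tuple m x m = Max (x ` {1..m})"
proof -
  assume "1 \<le> m"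
  then have "Max (sort_tuple m x ` {1..m}) = sort_tuple m x m"
    by (intro Max_eqI) (auto intro!: mono_onD[OF mono_on_sort_tuple])
  then show ?thesis by (simp only: sort_tuple_image)
qed

lemma continuous_on_sort_tuple: "continuous_on S (sort_tuple m)"
proof (rule continuous_on_coordinatewise_then_product)
  fix i
  show "continuous_on S (\<lambda>x. sort_tuple m x i)"
  proof (cases "i \<in> {1..m}")
    case False
    then show ?thesis unfolding sort_tuple_def by auto
  next
    case i: True
    show ?thesis
      unfolding continuous_on_def
    proof (intro ballI tendstoI)
      fix x e assume "x \<in> S" "(0::real) < e"
      have "\<forall>\<^sub>F y in at x within S. \<forall>j\<in>{1..m}. dist (y j) (x j) < e / 2"
      proof (rule eventually_ball_finite, simp, intro ballI tendstoD)
        fix j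
        have "continuous_on S (\<lambda>y::nat \<Rightarrow> real. y j)"
          by (rule continuous_on_subset[OF continuous_on_product_coordinates]) simp
        then show "((\<lambda>y. y j) \<longlongrightarrow> x j) (at x within S)"
          using \<open>x \<in> S\<close> by (simp add: continuous_on_def)
      qed (use \<open>0 < e\<close> in simp)
      then show "\<forall>\<^sub>F y in at x within S. dist (sort_tuple m y i) (sort_tuple m x i) < e"
      proof eventually_elim
        case (elim y)
        have "y j \<le> x j + e / 2" "x j \<le> y j + e / 2" if "j \<in> {1..m}" for j
          using bspec[OF elim that] unfolding dist_real_def by linarith+
        note close = this
        have "sort_tuple m y i \<le> sort_tuple m x i + e / 2"
          by (intro sort_tuple_le_add i close)
        moreover have "sort_tuple m x i \<le> sort_tuple m y i + e / 2"
          by (intro sort_tuple_le_add i close)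
        ultimately show ?case using \<open>0 < e\<close> by (simp add: dist_real_def)
      qed
    qed
  qed
qed

section \<open>Extremal values of a strictly internal mean\<close>

lemma is_mean_ge:
  assumes "is_mean n I K" "x \<in> tuples n I" "1 \<le> n" "\<And>l. l \<in> {1..n} \<Longrightarrow> c \<le> x l"
  shows "c \<le> K x"
proof -
  have "c \<le> Min (x ` {1..n})" using assms(3,4) by simp
  also have "\<dots> \<le> K x" using assms(1,2) by (simp add: is_mean_def)
  finally show ?thesis .
qed

lemma is_mean_le:
  assumes "is_mean n I K" "x \<in> tuples n I" "1 \<le> n" "\<And>l. l \<in> {1..n} \<Longrightarrow> x l \<le> c"
  shows "K x \<le> c"
proof -
  have "K x \<le> Max (x ` {1..n})" using assms(1,2) by (simp add: is_mean_def)
  also have "\<dots> \<le> c" using assms(3,4) by simp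
  finally show ?thesis .
qed

text \<open>
  Strict internality covers only non-constant tuples, and on these it makes the value differ from
  every bound. On a constant tuple the value is the common entry by the mean property.
\<close>

lemma mean_extremal_imp_constant:
  assumes mean: "is_mean n I K" and strict: "strictly_internal n I K"
    and x: "x \<in> tuples n I" and l: "l \<in> {1..n}"
    and bound: "(\<forall>j\<in>{1..n}. K x \<le> x j) \<or> (\<forall>j\<in>{1..n}. x j \<le> K x)"
  shows "x l = K x"
proof -
  have n: "1 \<le> n" using l by simp
  have const: "\<forall>i\<in>{1..n}. \<forall>j\<in>{1..n}. x i = x j"
  proof (rule ccontr)
    assume "\<not> ?thesis"
    then have "Min (x ` {1..n}) < K x" "K x < Max (x ` {1..n})"
      using strict x unfolding strictly_internal_def by blast+
    then obtain i j where "i \<in> {1..n}" "x i < K x" "j \<in> {1..n}" "K x < x j"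
      using n by (auto simp: Min_less_iff Max_gr_iff)
    then show False using bound by force
  qed
  have "x l \<le> K x"
    using const l by (intro is_mean_ge[OF mean x n]) (metis order_refl)
  moreover have "K x \<le> x l"
    using const l by (intro is_mean_le[OF mean x n]) (metis order_refl)
  ultimately show ?thesis by simp
qed

text \<open>
  Suppose that coordinate \<open>l\<close> reaches some \<open>y > \<alpha>\<close>. Lowering it to \<open>y\<close> and all other coordinates to \<open>c k\<close>
  does not raise the mean. The lowered value tends to the mean of the tuple with
  one entry \<open>y\<close> and all others \<open>\<alpha>\<close>, which exceeds \<open>\<alpha>\<close>; as the original value tends to
  \<open>\<alpha>\<close>, this can happen only for finitely many \<open>k\<close>.
\<close>

lemma coordinates_tendsto_lower_bound:
  fixes x :: "nat \<Rightarrow> nat \<Rightarrow> real"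
  assumes I: "is_interval I"
    and mean: "is_mean n I K" and strict: "strictly_internal n I K"
    and mono: "monotone_mean n I K" and cont: "continuous_mean n I K"
    and x: "\<And>k. x k \<in> tuples n I"
    and c: "\<And>k. c k \<in> I" "c \<longlonglongrightarrow> \<alpha>" "\<alpha> \<in> I"
    and low: "\<And>k j. j \<in> {1..n} \<Longrightarrow> c k \<le> x k j"
    and lim: "(\<lambda>k. K (x k)) \<longlonglongrightarrow> \<alpha>"
    and l: "l \<in> {1..n}"
  shows "(\<lambda>k. x k l) \<longlonglongrightarrow> \<alpha>"
proof (rule order_tendstoI)
  fix y assume "y < \<alpha>"
  with c(2) have "\<forall>\<^sub>F k in sequentially. y < c k" by (rule order_tendstoD)
  then show "\<forall>\<^sub>F k in sequentially. y < x k l"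
    by eventually_elim (use low[OF l] less_le_trans in blast)
next
  fix y assume y: "\<alpha> < y"
  show "\<forall>\<^sub>F k in sequentially. x k l < y"
  proof (cases "y \<in> I")
    case False
    \<comment> \<open>An entry reaching \<open>y\<close> would put \<open>y\<close> between two points of the interval.\<close>
    have "x k l < y" for k
    proof (rule ccontr)
      assume "\<not> x k l < y"
      moreover have "x k l \<in> I" using x[of k] l by auto
      ultimately show False
        using mem_is_interval_1_I[OF I c(3), of "x k l" y] y False by auto
    qed
    then show ?thesis by simp
  next
    case True
    define z where "z s = (\<lambda>j\<in>{1..n}. if j = l then y else s)" for s
    have zI: "z s \<in> tuples n I" if "s \<in> I" for s
      using that True by (auto simp: z_def)
    have "continuous_on I (\<lambda>s. z s j)" for j
      by (cases "j \<in> {1..n}"; cases "j = l") (auto simp: z_def)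
    then have "continuous_on I z" by (rule continuous_on_coordinatewise_then_product)
    then have "continuous_on I (\<lambda>s. K (z s))"
      using zI by (intro continuous_on_compose2[OF cont[unfolded continuous_mean_def]]) blast+
    then have Kz: "(\<lambda>k. K (z (c k))) \<longlonglongrightarrow> K (z \<alpha>)"
      using c by (intro continuous_on_tendsto_compose[of I "\<lambda>s. K (z s)"]) auto
    have "\<alpha> \<le> K (z \<alpha>)"
      using l y by (intro is_mean_ge[OF mean zI[OF c(3)]]) (auto simp: z_def)
    moreover have "K (z \<alpha>) \<noteq> \<alpha>"
    proof
      assume eq: "K (z \<alpha>) = \<alpha>"
      then have "\<forall>j\<in>{1..n}. K (z \<alpha>) \<le> z \<alpha> j" using y by (simp add: z_def)
      then have "z \<alpha> l = \<alpha>"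
        using mean_extremal_imp_constant[OF mean strict zI[OF c(3)] l] eq by metis
      then show False using l y by (simp add: z_def)
    qed
    ultimately obtain q where q: "\<alpha> < q" "q < K (z \<alpha>)"
      using dense[of \<alpha> "K (z \<alpha>)"] by auto
    have "\<forall>\<^sub>F k in sequentially. K (x k) < q" "\<forall>\<^sub>F k in sequentially. q < K (z (c k))"
      using order_tendstoD(2)[OF lim q(1)] order_tendstoD(1)[OF Kz q(2)] by auto
    then show ?thesis
    proof eventually_elim
      case (elim k)
      show ?case
      proof (rule ccontr)
        assume "\<not> x k l < y"
        then have "\<forall>j\<in>{1..n}. z (c k) j \<le> x k j"
          using low[of _ k] by (auto simp: z_def)
        then have "K (z (c k)) \<le> K (x k)"
          using mono x zI[OF c(1)] by (auto simp: monotone_mean_def)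
        with elim show False by simp
      qed
    qed
  qed
qed

section \<open>Iteration of a system of means\<close>

text \<open>
  The last two assumptions, mirror images of each other, are the connectivity behind the
  theorem: \<open>link_up\<close> lets information about the first \<open>i\<close> entries reach an entry beyond
  \<open>i\<close>, and \<open>link_down\<close> lets information about the entries after \<open>i\<close> reach an entry at most
  \<open>i\<close>. The adjacent entry itself need not be read: as the iterates stay nondecreasing, it is
  squeezed by the entry that is.
\<close>

locale linked_mean_system =
  fixes n m :: nat and I :: "real set"
    and K :: "nat \<Rightarrow> (nat \<Rightarrow> real) \<Rightarrow> real"
    and t :: "nat \<Rightarrow> nat \<Rightarrow> nat"
  assumes n: "1 \<le> n" and m: "1 \<le> m" and interval: "is_interval I"
    and mean: "\<And>i. i \<in> {1..m} \<Longrightarrow> is_mean n I (K i)"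
    and strict: "\<And>i. i \<in> {1..m} \<Longrightarrow> strictly_internal n I (K i)"
    and monotone: "\<And>i. i \<in> {1..m} \<Longrightarrow> monotone_mean n I (K i)"
    and cont: "\<And>i. i \<in> {1..m} \<Longrightarrow> continuous_mean n I (K i)"
    and K_le_Suc: "\<And>i x. i \<in> {1..<m} \<Longrightarrow> x \<in> tuples n I \<Longrightarrow> K i x \<le> K (Suc i) x"
    and t_range: "\<And>i l. i \<in> {1..m} \<Longrightarrow> l \<in> {1..n} \<Longrightarrow> t i l \<in> {1..m}"
    and t_le_Suc: "\<And>i l. i \<in> {1..<m} \<Longrightarrow> l \<in> {1..n} \<Longrightarrow> t i l \<le> t (Suc i) l"
    and link_up: "\<And>i. i \<in> {1..<m} \<Longrightarrow> \<exists>j\<in>{1..i}. \<exists>l\<in>{1..n}. i < t j l"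
    and link_down: "\<And>i. i \<in> {1..<m} \<Longrightarrow> \<exists>j\<in>{i<..m}. \<exists>l\<in>{1..n}. t j l \<le> i"
begin

abbreviation iter :: "(nat \<Rightarrow> real) \<Rightarrow> nat \<Rightarrow> nat \<Rightarrow> real" where
  "iter \<equiv> mean_iter n m K t"

abbreviation select :: "nat \<Rightarrow> (nat \<Rightarrow> real) \<Rightarrow> nat \<Rightarrow> real" where
  "select i b \<equiv> (\<lambda>l\<in>{1..n}. b (t i l))"

abbreviation lim_mean :: "(nat \<Rightarrow> real) \<Rightarrow> real" where
  "lim_mean \<equiv> limit_mean n m K t"

lemma select_tuples: "b \<in> tuples m I \<Longrightarrow> i \<in> {1..m} \<Longrightarrow> select i b \<in> tuples n I"
  using t_range by (auto simp: PiE_iff)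

lemma iter_Suc_eq: "i \<in> {1..m} \<Longrightarrow> iter a (Suc k) i = K i (select i (iter a k))"
  by simp

lemma iter_tuples: "a \<in> tuples m I \<Longrightarrow> iter a k \<in> tuples m I"
proof (induction k)
  case (Suc k)
  have "K i (select i (iter a k)) \<in> I" if "i \<in> {1..m}" for i
    using mean[OF that] select_tuples[OF Suc.IH[OF Suc.prems] that] by (simp add: is_mean_def)
  then show ?case by auto
qed simp

lemma iter_mono:
  assumes "a \<in> tuples m I" "b \<in> tuples m I" "\<And>i. i \<in> {1..m} \<Longrightarrow> a i \<le> b i" "i \<in> {1..m}"
  shows "iter a k i \<le> iter b k i"
  using assms(4)
proof (induction k arbitrary: i)
  case (Suc k)
  have "K i (select i (iter a k)) \<le> K i (select i (iter b k))"
    using monotone[OF Suc.prems] select_tuples[OF iter_tuples Suc.prems] assms(1,2)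
      Suc.IH t_range[OF Suc.prems]
    by (auto simp: monotone_mean_def)
  then show ?case using Suc.prems by simp
qed (use assms in simp)

lemma mono_on_iter:
  assumes "a \<in> tuples m I" "mono_on {1..m} a"
  shows "mono_on {1..m} (iter a k)"
proof (induction k)
  case (Suc k)
  let ?b = "iter a k"
  have Suc_le: "iter a (Suc k) i \<le> iter a (Suc k) (Suc i)" if i: "i \<in> {1..<m}" for i
  proof -
    have i': "i \<in> {1..m}" "Suc i \<in> {1..m}" using i by auto
    note sel = select_tuples[OF iter_tuples[OF assms(1)]]
    have "K i (select i ?b) \<le> K (Suc i) (select i ?b)"
      using K_le_Suc[OF i sel[OF i'(1)]] .
    also have "\<dots> \<le> K (Suc i) (select (Suc i) ?b)"
      using monotone[OF i'(2)] sel[OF i'(1)] sel[OF i'(2)]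
        mono_onD[OF Suc.IH t_range[OF i'(1)] t_range[OF i'(2)] t_le_Suc[OF i]]
      unfolding monotone_mean_def by auto
    finally show ?thesis using i' by simp
  qed
  show ?case
  proof (rule mono_onI)
    fix r s assume rs: "r \<in> {1..m}" "s \<in> {1..m}" "r \<le> s"
    from rs(3) show "iter a (Suc k) r \<le> iter a (Suc k) s" using rs(2)
    proof (induction s rule: dec_induct)
      case (step s)
      then show ?case
        using Suc_le[of s] rs(1) by fastforce
    qed simp
  qed
qed (use assms in simp)

context
  fixes a assumes a: "a \<in> tuples m I" "mono_on {1..m} a"
begin

lemma iter_in: "i \<in> {1..m} \<Longrightarrow> iter a k i \<in> I"
  using iter_tuples[OF a(1)] by blast

lemma iter_le: "i \<in> {1..m} \<Longrightarrow> j \<in> {1..m} \<Longrightarrow> i \<le> j \<Longrightarrow> iter a k i \<le> iter a k j"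
  using mono_onD[OF mono_on_iter[OF a]] .

lemma incseq_iter_first: "incseq (\<lambda>k. iter a k 1)"
proof (rule incseq_SucI)
  fix k
  have 1: "1 \<in> {1..m}" using m by simp
  show "iter a k 1 \<le> iter a (Suc k) 1"
    unfolding iter_Suc_eq[OF 1]
    using iter_le[OF 1 t_range[OF 1]] t_range[OF 1]
    by (intro is_mean_ge[OF mean[OF 1] select_tuples[OF iter_tuples[OF a(1)] 1] n]) auto
qed

lemma decseq_iter_last: "decseq (\<lambda>k. iter a k m)"
proof (rule decseq_SucI)
  fix k
  have mm: "m \<in> {1..m}" using m by simp
  show "iter a (Suc k) m \<le> iter a k m"
    unfolding iter_Suc_eq[OF mm]
    using iter_le[OF t_range[OF mm] mm] t_range[OF mm]
    by (intro is_mean_le[OF mean[OF mm] select_tuples[OF iter_tuples[OF a(1)] mm] n]) auto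
qed

text \<open>
  Induction on \<open>i\<close>: a linked \<open>t j\<close> with \<open>j \<le> i\<close> has mean values tending to \<open>\<alpha>\<close>, hence so do the
  entries it reads. One of them lies beyond \<open>i\<close>, and it bounds entry \<open>Suc i\<close> from above.
\<close>

lemma iter_tendsto_common:
  obtains L where "\<And>i. i \<in> {1..m} \<Longrightarrow> (\<lambda>k. iter a k i) \<longlonglongrightarrow> L"
proof -
  have 1: "1 \<in> {1..m}" and mm: "m \<in> {1..m}" using m by auto
  have bnd: "iter a k 1 \<le> a m" for k
    using iter_le[OF 1 mm m, of k] decseqD[OF decseq_iter_last, of 0 k] by simp
  obtain \<alpha> where \<alpha>: "(\<lambda>k. iter a k 1) \<longlonglongrightarrow> \<alpha>" "\<And>k. iter a k 1 \<le> \<alpha>"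
    using incseq_convergent[OF incseq_iter_first, of "a m"] bnd by auto
  have "\<alpha> \<le> a m" using LIMSEQ_le_const2[OF \<alpha>(1)] bnd by blast
  then have \<alpha>I: "\<alpha> \<in> I"
    using mem_is_interval_1_I[OF interval, of "a 1" "a m" \<alpha>] \<alpha>(2)[of 0] iter_in[OF 1, of 0]
      iter_in[OF mm, of 0] by simp
  have "\<forall>j\<in>{1..i}. (\<lambda>k. iter a k j) \<longlonglongrightarrow> \<alpha>" if "i \<in> {1..m}" for i
    using that
  proof (induction i)
    case (Suc i)
    show ?case
    proof (cases "i = 0")
      case True
      then show ?thesis using \<alpha>(1) by simp
    next
      case False
      then have i: "i \<in> {1..<m}" using Suc.prems by auto
      then have IH: "\<forall>j\<in>{1..i}. (\<lambda>k. iter a k j) \<longlonglongrightarrow> \<alpha>" using Suc.IH by simp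
      obtain j l where jl: "j \<in> {1..i}" "l \<in> {1..n}" "i < t j l"
        using link_up[OF i] by blast
      then have j: "j \<in> {1..m}" using i by auto
      \<comment> \<open>The mean value at time \<open>k\<close> is entry \<open>j\<close> at time \<open>Suc k\<close>.\<close>
      have "(\<lambda>k. K j (select j (iter a k))) \<longlonglongrightarrow> \<alpha>"
        using LIMSEQ_Suc[OF bspec[OF IH jl(1)]] j by simp
      then have "(\<lambda>k. select j (iter a k) l) \<longlonglongrightarrow> \<alpha>"
        using iter_le[OF 1] t_range[OF j] iter_in[OF 1] jl(2)
        by (intro coordinates_tendsto_lower_bound[OF interval mean[OF j] strict[OF j]
              monotone[OF j] cont[OF j] select_tuples[OF iter_tuples[OF a(1)] j]
              _ \<alpha>(1) \<alpha>I]) auto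
      then have up: "(\<lambda>k. iter a k (t j l)) \<longlonglongrightarrow> \<alpha>" using jl(2) by simp
      have "(\<lambda>k. iter a k (Suc i)) \<longlonglongrightarrow> \<alpha>"
        using iter_le[OF 1 Suc.prems] iter_le[OF Suc.prems t_range[OF j jl(2)]] jl(3)
        by (intro tendsto_sandwich[OF _ _ \<alpha>(1) up]) auto
      then show ?thesis using IH by (auto simp: le_Suc_eq)
    qed
  qed simp
  then show ?thesis using that by (meson atLeastAtMost_iff order_refl)
qed

text \<open>
  The same induction with equality for all \<open>k\<close> in place of limits. The equality is needed for all
  times at once, since entry \<open>j\<close> at time \<open>Suc k\<close> yields the arguments at time \<open>k\<close>.
\<close>

lemma iter_first_constant_imp_constant:
  assumes "\<And>k. iter a k 1 = \<alpha>" "i \<in> {1..m}"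
  shows "iter a k i = \<alpha>"
proof -
  have 1: "1 \<in> {1..m}" using m by auto
  have "\<forall>j\<in>{1..i}. \<forall>k. iter a k j = \<alpha>"
    using assms(2)
  proof (induction i)
    case (Suc i)
    show ?case
    proof (cases "i = 0")
      case True
      then show ?thesis using assms(1) by simp
    next
      case False
      then have i: "i \<in> {1..<m}" using Suc.prems by auto
      then have IH: "\<forall>j\<in>{1..i}. \<forall>k. iter a k j = \<alpha>" using Suc.IH by simp
      obtain j l where jl: "j \<in> {1..i}" "l \<in> {1..n}" "i < t j l"
        using link_up[OF i] by blast
      then have j: "j \<in> {1..m}" using i by auto
      have "iter a k (Suc i) = \<alpha>" for k
      proof -
        have K: "K j (select j (iter a k)) = \<alpha>"
          using IH jl(1) iter_Suc_eq[OF j, of a k] by metis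
        have "iter a k (t j l) = \<alpha>"
          using mean_extremal_imp_constant[OF mean[OF j] strict[OF j]
              select_tuples[OF iter_tuples[OF a(1)] j] jl(2), of k]
            iter_le[OF 1 t_range[OF j], of _ k] t_range[OF j] jl(2)
          unfolding K assms(1) by auto
        then show ?thesis
          using iter_le[OF 1 Suc.prems, of k] iter_le[OF Suc.prems t_range[OF j jl(2)], of k]
            jl(3) assms(1)[of k] by auto
      qed
      then show ?thesis using IH by (auto simp: le_Suc_eq)
    qed
  qed simp
  then show ?thesis using assms(2) by auto
qed

lemma iter_last_constant_imp_constant:
  assumes "\<And>k. iter a k m = \<beta>" "i \<in> {1..m}"
  shows "iter a k i = \<beta>"
proof -
  have mm: "m \<in> {1..m}" using m by auto
  have "i \<le> m" using assms(2) by simp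
  then have "1 \<le> i \<longrightarrow> (\<forall>j\<in>{i..m}. \<forall>k. iter a k j = \<beta>)"
  proof (induction i rule: inc_induct)
    case base
    then show ?case using assms(1) by simp
  next
    case (step i)
    show ?case
    proof
      assume "1 \<le> i"
      then have i: "i \<in> {1..<m}" "i \<in> {1..m}" using step.hyps by auto
      have IH: "\<forall>j\<in>{Suc i..m}. \<forall>k. iter a k j = \<beta>" using step.IH by simp
      obtain j l where jl: "j \<in> {i<..m}" "l \<in> {1..n}" "t j l \<le> i"
        using link_down[OF i(1)] by blast
      then have j: "j \<in> {1..m}" "j \<in> {Suc i..m}" by auto
      have "iter a k i = \<beta>" for k
      proof -
        have K: "K j (select j (iter a k)) = \<beta>"
          using IH j(2) iter_Suc_eq[OF j(1), of a k] by metis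
        have "iter a k (t j l) = \<beta>"
          using mean_extremal_imp_constant[OF mean[OF j(1)] strict[OF j(1)]
              select_tuples[OF iter_tuples[OF a(1)] j(1)] jl(2), of k]
            iter_le[OF t_range[OF j(1)] mm, of _ k] t_range[OF j(1)] jl(2)
          unfolding K assms(1) by auto
        then show ?thesis
          using iter_le[OF i(2) mm, of k] iter_le[OF t_range[OF j(1) jl(2)] i(2), of k]
            jl(3) i assms(1)[of k] by auto
      qed
      then show "\<forall>j\<in>{i..m}. \<forall>k. iter a k j = \<beta>" using IH
        by (metis Suc_leI atLeastAtMost_iff le_neq_implies_less)
    qed
  qed
  then show ?thesis using assms(2) by auto
qed

text \<open>
  The first entry is nondecreasing in \<open>k\<close> and stays below \<open>L\<close>, so \<open>L = a 1\<close> would freeze it; a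
  frozen first entry forces a constant initial tuple. The last entry is treated dually.
\<close>

lemma limit_strict:
  assumes lim: "\<And>i. i \<in> {1..m} \<Longrightarrow> (\<lambda>k. iter a k i) \<longlonglongrightarrow> L" and "a 1 < a m"
  shows "a 1 < L" "L < a m"
proof -
  have 1: "1 \<in> {1..m}" and mm: "m \<in> {1..m}" using m by auto
  have first: "iter a k 1 \<le> L" and last: "L \<le> iter a k m" for k
    using incseq_le[OF incseq_iter_first lim[OF 1]] decseq_ge[OF decseq_iter_last lim[OF mm]]
    by auto
  show "a 1 < L"
  proof (rule ccontr)
    assume "\<not> a 1 < L"
    then have "iter a k 1 = a 1" for k
      using first[of k] incseqD[OF incseq_iter_first, of 0 k] by simp
    then have "iter a 0 m = a 1" using iter_first_constant_imp_constant mm by blast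
    then show False using assms(2) by simp
  qed
  show "L < a m"
  proof (rule ccontr)
    assume "\<not> L < a m"
    then have "iter a k m = a m" for k
      using last[of k] decseqD[OF decseq_iter_last, of 0 k] by simp
    then have "iter a 0 1 = a m" using iter_last_constant_imp_constant 1 by blast
    then show False using assms(2) by simp
  qed
qed

end

section \<open>The limit as a mean\<close>

context
  fixes x assumes x: "x \<in> tuples m I"
begin

lemma lim_mean_tendsto:
  assumes "i \<in> {1..m}"
  shows "(\<lambda>k. iter (sort_tuple m x) k i) \<longlonglongrightarrow> lim_mean x"
proof -
  obtain L where L: "\<And>i. i \<in> {1..m} \<Longrightarrow> (\<lambda>k. iter (sort_tuple m x) k i) \<longlonglongrightarrow> L"
    using iter_tendsto_common[OF sort_tuple_tuples[OF x] mono_on_sort_tuple] by blast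
  have "lim_mean x = L"
    unfolding limit_mean_def
  proof (rule the_equality)
    fix L' assume "\<forall>i\<in>{1..m}. (\<lambda>k. iter (sort_tuple m x) k i) \<longlonglongrightarrow> L'"
    then have "(\<lambda>k. iter (sort_tuple m x) k m) \<longlonglongrightarrow> L'" using m by simp
    moreover have "(\<lambda>k. iter (sort_tuple m x) k m) \<longlonglongrightarrow> L" using L m by simp
    ultimately show "L' = L" by (rule LIMSEQ_unique)
  qed (use L in blast)
  with L assms show ?thesis by simp
qed

lemma iter_first_le_lim_mean: "iter (sort_tuple m x) k 1 \<le> lim_mean x"
  using incseq_le[OF incseq_iter_first[OF sort_tuple_tuples[OF x] mono_on_sort_tuple]
      lim_mean_tendsto] m by simp

lemma lim_mean_le_iter_last: "lim_mean x \<le> iter (sort_tuple m x) k m"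
  using decseq_ge[OF decseq_iter_last[OF sort_tuple_tuples[OF x] mono_on_sort_tuple]
      lim_mean_tendsto] m by simp

lemma Min_le_lim_mean: "Min (x ` {1..m}) \<le> lim_mean x"
  using iter_first_le_lim_mean[of 0] sort_tuple_first[OF m, of x] by simp

lemma lim_mean_le_Max: "lim_mean x \<le> Max (x ` {1..m})"
  using lim_mean_le_iter_last[of 0] sort_tuple_last[OF m, of x] by simp

end

lemma is_mean_lim_mean: "is_mean m I lim_mean"
  unfolding is_mean_def
proof (intro ballI conjI)
  fix x assume x: "x \<in> tuples m I"
  have "Min (x ` {1..m}) \<in> x ` {1..m}" "Max (x ` {1..m}) \<in> x ` {1..m}" using m by simp_all
  then have "Min (x ` {1..m}) \<in> I" "Max (x ` {1..m}) \<in> I" using x by auto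
  then show "lim_mean x \<in> I"
    using mem_is_interval_1_I[OF interval] Min_le_lim_mean[OF x] lim_mean_le_Max[OF x] by blast
qed (fact Min_le_lim_mean lim_mean_le_Max)+

lemma strictly_internal_lim_mean: "strictly_internal m I lim_mean"
  unfolding strictly_internal_def
proof (intro ballI impI)
  fix x assume x: "x \<in> tuples m I" and "\<exists>i\<in>{1..m}. \<exists>j\<in>{1..m}. x i \<noteq> x j"
  then obtain i j where ij: "i \<in> {1..m}" "j \<in> {1..m}" "x i < x j"
    by (metis linorder_neqE)
  then have "Min (x ` {1..m}) < Max (x ` {1..m})"
    by (meson Max_ge Min_le finite_atLeastAtMost finite_imageI imageI le_less_trans less_le_trans)
  then show "Min (x ` {1..m}) < lim_mean x \<and> lim_mean x < Max (x ` {1..m})"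
    using limit_strict[OF sort_tuple_tuples[OF x] mono_on_sort_tuple lim_mean_tendsto[OF x]]
    by (simp only: sort_tuple_first[OF m] sort_tuple_last[OF m])
qed

lemma monotone_lim_mean: "monotone_mean m I lim_mean"
  unfolding monotone_mean_def
proof (intro ballI impI)
  fix x y assume xy: "x \<in> tuples m I" "y \<in> tuples m I" and le: "\<forall>i\<in>{1..m}. x i \<le> y i"
  have 1: "1 \<in> {1..m}" using m by simp
  have "sort_tuple m x i \<le> sort_tuple m y i" if "i \<in> {1..m}" for i
    using sort_tuple_le_add[of m x y 0 i] le that by simp
  then have "iter (sort_tuple m x) k 1 \<le> iter (sort_tuple m y) k 1" for k
    by (intro iter_mono sort_tuple_tuples xy 1)
  then show "lim_mean x \<le> lim_mean y"
    by (intro LIMSEQ_le[OF lim_mean_tendsto[OF xy(1) 1] lim_mean_tendsto[OF xy(2) 1]]) auto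
qed

lemma continuous_on_iter:
  "continuous_on (tuples m I) (\<lambda>x. iter (sort_tuple m x) k i)"
proof (induction k arbitrary: i)
  case 0
  show ?case
    using continuous_on_product_then_coordinatewise[OF continuous_on_sort_tuple] by simp
next
  case (Suc k)
  show ?case
  proof (cases "i \<in> {1..m}")
    case False
    then show ?thesis by auto
  next
    case i: True
    have "continuous_on (tuples m I) (\<lambda>x. select i (iter (sort_tuple m x) k))"
    proof (rule continuous_on_coordinatewise_then_product)
      fix l
      show "continuous_on (tuples m I) (\<lambda>x. select i (iter (sort_tuple m x) k) l)"
        using Suc.IH by (cases "l \<in> {1..n}") auto
    qed
    then have "continuous_on (tuples m I) (\<lambda>x. K i (select i (iter (sort_tuple m x) k)))"
      using select_tuples[OF iter_tuples[OF sort_tuple_tuples] i]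
      by (intro continuous_on_compose2[OF cont[OF i, unfolded continuous_mean_def]]) blast+
    then show ?thesis unfolding iter_Suc_eq[OF i] .
  qed
qed

text \<open>
  A strict bound on the limit at \<open>x\<close> already holds for the first or last entry after finitely many
  steps; there it is an open condition on the initial tuple, and that entry bounds the limit at
  every nearby tuple as well.
\<close>

lemma continuous_lim_mean: "continuous_mean m I lim_mean"
  unfolding continuous_mean_def continuous_on_def
proof (intro ballI order_tendstoI)
  fix x c assume x: "x \<in> tuples m I"
  let ?F = "at x within tuples m I"
  have near: "((\<lambda>y. iter (sort_tuple m y) k i) \<longlongrightarrow> iter (sort_tuple m x) k i) ?F" for k i
    using continuous_on_iter x by (simp add: continuous_on_def)
  have inF: "\<forall>\<^sub>F y in ?F. y \<in> tuples m I" by (simp add: eventually_at_filter)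
  {
    assume c: "c < lim_mean x"
    obtain k where "c < iter (sort_tuple m x) k 1"
      using order_tendstoD(1)[OF lim_mean_tendsto[OF x, of 1] c] m
      by (auto simp: eventually_sequentially)
    from inF order_tendstoD(1)[OF near this] show "\<forall>\<^sub>F y in ?F. c < lim_mean y"
      by eventually_elim (use iter_first_le_lim_mean less_le_trans in blast)
  next
    assume c: "lim_mean x < c"
    obtain k where "iter (sort_tuple m x) k m < c"
      using order_tendstoD(2)[OF lim_mean_tendsto[OF x, of m] c] m
      by (auto simp: eventually_sequentially)
    from inF order_tendstoD(2)[OF near this] show "\<forall>\<^sub>F y in ?F. lim_mean y < c"
      by eventually_elim (use lim_mean_le_iter_last le_less_trans in blast)
  }
qed

end

section \<open>Admissible systems\<close>

text \<open>
  Counting the pairs (tuple, index occurring in it) gives \<open>m * n\<close> in total. Each of the \<open>m\<close> tuples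
  contributes at most \<open>n\<close>, so each contributes exactly \<open>n\<close>.
\<close>

lemma admissible_inj_on:
  assumes adm: "admissible n m t" and i: "i \<in> {1..m}"
  shows "inj_on (t i) {1..n}"
proof -
  have range: "\<And>i. i \<in> {1..m} \<Longrightarrow> t i ` {1..n} \<subseteq> {1..m}"
    and count: "\<forall>k\<in>{1..m}. card {i\<in>{1..m}. k \<in> t i ` {1..n}} = n"
    using adm by (auto simp: admissible_def)
  have le: "card (t i ` {1..n}) \<le> n" for i
    using card_image_le[of "{1..n}" "t i"] by simp
  have "(\<Sum>i\<in>{1..m}. card {k\<in>{1..m}. k \<in> t i ` {1..n}}) = n * card {1..m}"
    using count by (intro sum_multicount) auto
  moreover have "{k\<in>{1..m}. k \<in> t i ` {1..n}} = t i ` {1..n}" if "i \<in> {1..m}" for i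
    using range[OF that] by blast
  ultimately have "(\<Sum>i\<in>{1..m}. card (t i ` {1..n})) = (\<Sum>i\<in>{1..m}. n)"
    by simp
  then have "card (t i ` {1..n}) = n"
    using sum_mono_inv[of "\<lambda>i. card (t i ` {1..n})" "{1..m}" "\<lambda>_. n" i] le i by simp
  then show ?thesis by (simp add: eq_card_imp_inj_on)
qed

lemma admissible_link_up:
  assumes "admissible n m t" "i \<in> {1..<m}"
  shows "\<exists>j\<in>{1..i}. \<exists>l\<in>{1..n}. i < t j l"
proof -
  have "Suc i \<in> {2..m}" using assms(2) by auto
  then obtain j where "j \<in> {1..<Suc i}" "Suc i \<in> t j ` {1..n}"
    using assms(1) unfolding admissible_def by blast
  then show ?thesis by (metis atLeastLessThanSuc_atLeastAtMost imageE lessI)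
qed

text \<open>
  The tuple \<open>t (Suc i)\<close> always works. For \<open>Suc i = m\<close> admissibility only gives a weak inequality
  for the minimum, but two distinct coordinates cannot both be \<open>m\<close>.
\<close>

lemma admissible_link_down:
  assumes adm: "admissible n m t" and n: "2 \<le> n" and i: "i \<in> {1..<m}"
  shows "\<exists>j\<in>{i<..m}. \<exists>l\<in>{1..n}. t j l \<le> i"
proof -
  have j: "Suc i \<in> {i<..m}" using i by auto
  have "\<exists>l\<in>{1..n}. t (Suc i) l < Suc i"
  proof (cases "Suc i = m")
    case False
    then have "Suc i \<in> {2..m-1}" using i by auto
    then have "Min (t (Suc i) ` {1..n}) < Suc i" using adm unfolding admissible_def by blast
    then show ?thesis using n by (subst (asm) Min_less_iff) auto
  next
    case True
    have "t (Suc i) 1 \<noteq> t (Suc i) 2"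
      using inj_onD[OF admissible_inj_on[OF adm, of "Suc i"], of 1 2] True n by auto
    moreover have "t (Suc i) 1 \<le> m" "t (Suc i) 2 \<le> m"
      using adm True n i by (auto simp: admissible_def PiE_iff)
    ultimately have "t (Suc i) 1 < Suc i \<or> t (Suc i) 2 < Suc i" using True by linarith
    moreover have "1 \<in> {1..n}" "2 \<in> {1..n}" using n by auto
    ultimately show ?thesis by blast
  qed
  then show ?thesis using j by (auto simp: less_Suc_eq_le)
qed

theorem theorem4p1:
  fixes n m :: nat and I :: "real set"
    and K :: "nat \<Rightarrow> (nat \<Rightarrow> real) \<Rightarrow> real"
    and t :: "nat \<Rightarrow> nat \<Rightarrow> nat"
  assumes "2 \<le> n" and "n < m"
    and "is_interval I"
    and "\<And>i. i \<in> {1..m} \<Longrightarrow> is_mean n I (K i)"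
    and "\<And>i. i \<in> {1..m} \<Longrightarrow> symmetric_mean n I (K i)"
    and "\<And>i. i \<in> {1..m} \<Longrightarrow> strictly_internal n I (K i)"
    and "\<And>i. i \<in> {1..m} \<Longrightarrow> monotone_mean n I (K i)"
    and "\<And>i. i \<in> {1..m} \<Longrightarrow> continuous_mean n I (K i)"
    and "\<And>i x. i \<in> {1..<m} \<Longrightarrow> x \<in> tuples n I \<Longrightarrow> K i x \<le> K (Suc i) x"
    and "admissible n m t"
  shows "(\<forall>a\<in>tuples m I. mono_on {1..m} a \<longrightarrow>
            (\<exists>L. (\<forall>i\<in>{1..m}. (\<lambda>k. mean_iter n m K t a k i) \<longlonglongrightarrow> L) \<and> a 1 \<le> L \<and> L \<le> a m))
       \<and> is_mean m I (limit_mean n m K t)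
       \<and> strictly_internal m I (limit_mean n m K t)
       \<and> monotone_mean m I (limit_mean n m K t)
       \<and> continuous_mean m I (limit_mean n m K t)"
proof -
  have range: "\<And>i l. i \<in> {1..m} \<Longrightarrow> l \<in> {1..n} \<Longrightarrow> t i l \<in> {1..m}"
    and le: "\<And>i l. i \<in> {1..<m} \<Longrightarrow> l \<in> {1..n} \<Longrightarrow> t i l \<le> t (Suc i) l"
    using assms(10) unfolding admissible_def by (blast intro: PiE_mem)+
  interpret linked_mean_system n m I K t
  proof unfold_locales
    show "1 \<le> n" "1 \<le> m" using assms(1,2) by simp_all
  qed (fact assms range le admissible_link_up[OF assms(10)]
      admissible_link_down[OF assms(10,1)])+
  have "\<exists>L. (\<forall>i\<in>{1..m}. (\<lambda>k. mean_iter n m K t a k i) \<longlonglongrightarrow> L) \<and> a 1 \<le> L \<and> L \<le> a m"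
    if a: "a \<in> tuples m I" "mono_on {1..m} a" for a
  proof -
    obtain L where L: "\<And>i. i \<in> {1..m} \<Longrightarrow> (\<lambda>k. iter a k i) \<longlonglongrightarrow> L"
      using iter_tendsto_common[OF a] by blast
    have "iter a 0 1 \<le> L" "L \<le> iter a 0 m"
      using m by (intro incseq_le[OF incseq_iter_first[OF a] L]
          decseq_ge[OF decseq_iter_last[OF a] L]; simp)+
    with L show ?thesis unfolding mean_iter.simps by blast
  qed
  then show ?thesis
    using is_mean_lim_mean strictly_internal_lim_mean monotone_lim_mean continuous_lim_mean
    by blast
qed

end
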